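(* Consider the set $\mathcal{F}=\{G:\mathbb{R}^+\to\mathbb{R}\}$. The maximum Tsallis entropy problem (or equivalently the maximum $q$-norm problem), with $q<1$, defined by $$\max_{G\in\mathcal{F}}H_q(G)\quad\text{subject to}\quad \int_0^{+\infty}zG(z)\,dz=\mu\ \text{ and }\ \int_0^{+\infty}G(z)\,dz=\theta,$$ has for unique solution $$G_*(z)=\alpha^{\frac{1}{q-1}}\left(1+\frac{\beta}{\alpha}z\right)^{\frac{1}{q-1}}\qquad(q\neq1),$$ where $\alpha\ge0$ and $\beta\ge0$. Moreover, for $1/2<q<1$, $$\mu=\frac{(q-1)^2}{q(2q-1)}\,\frac{\alpha^{\frac{2q-1}{q-1}}}{\beta^2},\qquad \theta=\frac{\alpha^{\frac{q}{q-1}}}{\beta}\,\frac{1-q}{q},\qquad \|G_*\|_q^q=\frac{\alpha^{\frac{2q-1}{q-1}}}{\beta}\,\frac{1-q}{2q-1}.$$ In the case $q=1$, the unique solution (of the same problem with $H_1$) is $$G_*(z)=\alpha\exp(-\beta z)$$ with constants $\alpha$ and $\beta$ such that $$\mu=\frac{\alpha}{\beta^2},\qquad\theta=\frac{\alpha}{\beta},$$ and the Shannon entropy is $$H_1(G_* )=-\frac{\alpha}{\beta}\log\alpha+\alpha .$$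
   Context: The Tsallis entropy of index $q\ge0$, $q\ne1$, of a function $G$ on $\mathbb{R}^+=[0,\infty)$ is $H_q(G)=\frac{1}{1-q}\left(\int_0^{+\infty}G(z)^q\,dz-1\right)$; the limit case $q=1$ is the Shannon entropy $H_1(G)=-\int_0^{+\infty}G(z)\log G(z)\,dz$. The $q$-norm is given by $\|G\|_q^q=\int_0^{+\infty}G(z)^q\,dz$. The first moment (mean) is not defined for $q<1/2$, which is why the explicit formulas are given for $1/2<q<1$.
   Formalization: The last term of H_1(G_* ) is corrected from α to α/β; for q ≤ 1/2, where G_* has infinite mean, the solution claim is only conditional on G_* meeting the constraints; G is taken nonnegative and measurable, μ, θ > 0, and uniqueness is almost everywhere. *)

theory Defs
  imports "HOL-Analysis.Analysis"
begin

text \<open>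
  Functions on the half line are represented by total functions on the reals of which only the
  values on \<open>{0..}\<close> matter; integrals are Lebesgue integrals over \<open>{0..}\<close>.
\<close>

abbreviation half_line :: "real measure" where
  "half_line \<equiv> lebesgue_on {0..}"

text \<open>
  The powers \<open>G z powr q\<close> and the integrand \<open>G z * ln (G z)\<close> are meaningful for nonnegative \<open>G\<close>
  only, so competitors are the nonnegative measurable functions. No integrability
  of the entropy integrand is demanded.
\<close>

definition competitors :: "(real \<Rightarrow> real) set" where
  "competitors = {G \<in> borel_measurable half_line. \<forall>z\<ge>0. G z \<ge> 0}"

definition feasible :: "real \<Rightarrow> real \<Rightarrow> (real \<Rightarrow> real) set" where
  "feasible \<mu> \<theta> = {G \<in> competitors.
     has_bochner_integral half_line (\<lambda>z. z * G z) \<mu> \<and> has_bochner_integral half_line G \<theta>}"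

text \<open>The quantity usually written as the \<open>q\<close>-th power of the \<open>q\<close>-norm; it may be infinite.\<close>

definition qnorm_power :: "real \<Rightarrow> (real \<Rightarrow> real) \<Rightarrow> ennreal" where
  "qnorm_power q G = (\<integral>\<^sup>+ z. ennreal (G z powr q) \<partial>half_line)"

definition qnorm :: "real \<Rightarrow> (real \<Rightarrow> real) \<Rightarrow> ennreal" where
  "qnorm q G = (if qnorm_power q G = \<infinity> then \<infinity>
                else ennreal (enn2real (qnorm_power q G) powr (1 / q)))"

text \<open>
  The negative part of the Shannon integrand may have infinite integral, in which case the
  entropy is minus infinity (the Bochner integral would be zero). The positive part has finite
  integral for every \<open>G\<close> of finite mass and mean, so the difference is never of the form
  infinity minus infinity there. Note that \<open>0 * ln 0 = 0\<close>.
\<close>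

definition shannon_entropy :: "(real \<Rightarrow> real) \<Rightarrow> ereal" where
  "shannon_entropy G =
     enn2ereal (\<integral>\<^sup>+ z. ennreal (- (G z * ln (G z))) \<partial>half_line) -
     enn2ereal (\<integral>\<^sup>+ z. ennreal (G z * ln (G z)) \<partial>half_line)"

definition tsallis_entropy :: "real \<Rightarrow> (real \<Rightarrow> real) \<Rightarrow> ereal" where
  "tsallis_entropy q G =
     (if q = 1 then shannon_entropy G
      else ereal (1 / (1 - q)) * (enn2ereal (qnorm_power q G) - 1))"

text \<open>Integrals do not see null sets, so uniqueness means uniqueness almost everywhere.\<close>

definition unique_maximizer ::
    "((real \<Rightarrow> real) \<Rightarrow> 'b::ord) \<Rightarrow> (real \<Rightarrow> real) set \<Rightarrow> (real \<Rightarrow> real) \<Rightarrow> bool" where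
  "unique_maximizer J S G \<longleftrightarrow>
     is_arg_max J (\<lambda>F. F \<in> S) G \<and>
     (\<forall>F. is_arg_max J (\<lambda>F. F \<in> S) F \<longrightarrow> (AE z in half_line. F z = G z))"

definition G_star :: "real \<Rightarrow> real \<Rightarrow> real \<Rightarrow> real \<Rightarrow> real" where
  "G_star q \<alpha> \<beta> z = \<alpha> powr (1 / (q - 1)) * (1 + \<beta> / \<alpha> * z) powr (1 / (q - 1))"

definition G_star1 :: "real \<Rightarrow> real \<Rightarrow> real \<Rightarrow> real" where
  "G_star1 \<alpha> \<beta> z = \<alpha> * exp (- \<beta> * z)"

end

theory Submission
  imports Defs "HOL-Real_Asymp.Real_Asymp"
begin

text \<open>
  The integrand \<open>\<phi>\<close> of the entropy (\<open>y powr q\<close> or \<open>- y * ln y\<close>) is strictly concave, so it lies below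
  its tangent at \<open>G z\<close>, touching it only there. The candidate is the function for which the slope
  \<open>\<phi>' (G z)\<close> is affine in \<open>z\<close>; the integral of \<open>\<phi>' (G z) * (F z - G z)\<close> then vanishes by the two moment
  constraints, whence the maximum and, from strictness, its uniqueness almost everywhere. For
  \<open>0 < q\<close>, \<open>G z powr q\<close> is itself an affine function times \<open>G z\<close>, so its integral is finite as soon
  as \<open>G\<close> is feasible; for \<open>q = 0\<close> the same identity shows that \<open>G\<close> is never feasible.
\<close>

section \<open>Integrals with values in the extended reals\<close>

text \<open>
  Takes the value \<open>- \<infinity>\<close> or \<open>\<infinity>\<close> when one of the two parts is infinite, and the junk value \<open>\<infinity>\<close>
  when both are.
\<close>

definition ext_integral :: "'a measure \<Rightarrow> ('a \<Rightarrow> real) \<Rightarrow> ereal" where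
  "ext_integral M f =
     enn2ereal (\<integral>\<^sup>+ x. ennreal (f x) \<partial>M) - enn2ereal (\<integral>\<^sup>+ x. ennreal (- f x) \<partial>M)"

lemma ext_integral_eq_integral:
  assumes "integrable M f"
  shows "ext_integral M f = ereal (\<integral>x. f x \<partial>M)"
proof -
  have "(\<integral>\<^sup>+ x. ennreal (f x) \<partial>M) \<noteq> \<infinity>" "(\<integral>\<^sup>+ x. ennreal (- f x) \<partial>M) \<noteq> \<infinity>"
    using assms by (auto simp: real_integrable_def)
  then show ?thesis
    unfolding ext_integral_def real_lebesgue_integral_def[OF assms]
    by (cases "\<integral>\<^sup>+ x. ennreal (f x) \<partial>M"; cases "\<integral>\<^sup>+ x. ennreal (- f x) \<partial>M")
       (auto simp: enn2ereal_ennreal)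
qed

text \<open>If \<open>f\<close> is integrable, the nonnegative function \<open>T - f\<close> has
  integral zero only when it vanishes almost everywhere. Otherwise the positive part of
  \<open>f\<close> still has finite integral, being dominated by that of \<open>T\<close>, so the
  negative part has infinite integral and the value is minus infinity. Competitors whose entropy
  integrand is not integrable are thus covered.\<close>

lemma ext_integral_le_integral:
  assumes f: "f \<in> borel_measurable M" and T: "integrable M T"
    and le: "\<And>x. x \<in> space M \<Longrightarrow> f x \<le> T x"
  shows "ext_integral M f \<le> ereal (\<integral>x. T x \<partial>M)"
    and "ext_integral M f = ereal (\<integral>x. T x \<partial>M) \<Longrightarrow> AE x in M. f x = T x"
proof -
  have "ext_integral M f \<le> ereal (\<integral>x. T x \<partial>M) \<and>
    (ext_integral M f = ereal (\<integral>x. T x \<partial>M) \<longrightarrow> (AE x in M. f x = T x))"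
  proof (cases "integrable M f")
    case True
    have "integrable M (\<lambda>x. T x - f x)"
      using T True by (rule Bochner_Integration.integrable_diff)
    moreover have "AE x in M. 0 \<le> T x - f x"
      by (rule AE_I2) (use le in force)
    ultimately have "(\<integral>x. T x - f x \<partial>M) = 0 \<longleftrightarrow> (AE x in M. T x - f x = 0)"
      by (rule integral_nonneg_eq_0_iff_AE)
    moreover have "(\<integral>x. T x - f x \<partial>M) = (\<integral>x. T x \<partial>M) - (\<integral>x. f x \<partial>M)"
      using T True by (rule Bochner_Integration.integral_diff)
    moreover have "(AE x in M. T x - f x = 0) \<longleftrightarrow> (AE x in M. f x = T x)"
      by (rule AE_cong) auto
    ultimately have "(\<integral>x. f x \<partial>M) = (\<integral>x. T x \<partial>M) \<longleftrightarrow> (AE x in M. f x = T x)"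
      by linarith
    then show ?thesis
      using integral_mono[OF True T le] by (simp add: ext_integral_eq_integral[OF True])
  next
    case False
    have "(\<integral>\<^sup>+ x. ennreal (f x) \<partial>M) \<le> (\<integral>\<^sup>+ x. ennreal (T x) \<partial>M)"
      by (intro nn_integral_mono ennreal_leI le)
    also have "\<dots> < \<infinity>"
      using T by (auto simp: real_integrable_def top.not_eq_extremum)
    finally have fin: "(\<integral>\<^sup>+ x. ennreal (f x) \<partial>M) < \<infinity>" .
    with False f have "(\<integral>\<^sup>+ x. ennreal (- f x) \<partial>M) = \<infinity>"
      by (auto simp: real_integrable_def)
    with fin have "ext_integral M f = - \<infinity>"
      unfolding ext_integral_def
      by (cases "\<integral>\<^sup>+ x. ennreal (f x) \<partial>M") (auto simp: enn2ereal_ennreal)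
    then show ?thesis by simp
  qed
  then show "ext_integral M f \<le> ereal (\<integral>x. T x \<partial>M)"
    and "ext_integral M f = ereal (\<integral>x. T x \<partial>M) \<Longrightarrow> AE x in M. f x = T x" by auto
qed

section \<open>Maximizers and the tangent argument\<close>

text \<open>Maximality refers only to the strict order that the objective induces on the admissible
  points, so objectives with values in different types can be exchanged.\<close>

lemma is_arg_max_cong_order:
  assumes "\<And>x y. P x \<Longrightarrow> P y \<Longrightarrow> f x < f y \<longleftrightarrow> g x < g y"
  shows "is_arg_max f P x \<longleftrightarrow> is_arg_max g P x"
  using assms by (auto simp: is_arg_max_def)

lemma unique_maximizer_cong_order:
  assumes "\<And>F G. F \<in> S \<Longrightarrow> G \<in> S \<Longrightarrow> I F < I G \<longleftrightarrow> J F < J G"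
  shows "unique_maximizer I S G \<longleftrightarrow> unique_maximizer J S G"
proof -
  have "is_arg_max I (\<lambda>F. F \<in> S) F \<longleftrightarrow> is_arg_max J (\<lambda>F. F \<in> S) F" for F
    by (rule is_arg_max_cong_order) (rule assms)
  then show ?thesis by (simp add: unique_maximizer_def)
qed

text \<open>
  The upper bound for \<open>\<phi>\<close> is affine in \<open>y\<close> with slope affine in \<open>z\<close>, so for feasible competitors
  its integral is the same number.
\<close>

lemma tangent_maximizer:
  fixes \<phi> :: "real \<Rightarrow> real"
  assumes G: "G \<in> feasible \<mu> \<theta>"
    and \<phi>: "\<phi> \<in> borel_measurable borel"
    and le: "\<And>y z. 0 \<le> y \<Longrightarrow> 0 \<le> z \<Longrightarrow> \<phi> y \<le> (c + d * z) * G z + (a + b * z) * y"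
    and eqD: "\<And>y z. 0 \<le> y \<Longrightarrow> 0 \<le> z \<Longrightarrow> \<phi> y = (c + d * z) * G z + (a + b * z) * y \<Longrightarrow> y = G z"
    and eq: "\<And>z. 0 \<le> z \<Longrightarrow> \<phi> (G z) = (c + d * z) * G z + (a + b * z) * G z"
  shows "unique_maximizer (\<lambda>F. ext_integral half_line (\<lambda>z. \<phi> (F z))) (feasible \<mu> \<theta>) G"
    and "ext_integral half_line (\<lambda>z. \<phi> (G z)) = ereal ((a + c) * \<theta> + (b + d) * \<mu>)"
proof -
  define T where "T F z = (c + d * z) * G z + (a + b * z) * F z" for F z
  have T: "has_bochner_integral half_line (T F) ((a + c) * \<theta> + (b + d) * \<mu>)"
    if "F \<in> feasible \<mu> \<theta>" for F
  proof -
    have "has_bochner_integral half_line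
        (\<lambda>z. (c * G z + d * (z * G z)) + (a * F z + b * (z * F z)))
        ((c * \<theta> + d * \<mu>) + (a * \<theta> + b * \<mu>))"
      using G that by (intro has_bochner_integral_add has_bochner_integral_mult_right)
        (auto simp: feasible_def)
    then show ?thesis by (simp add: T_def[abs_def] algebra_simps)
  qed
  have bound: "ext_integral half_line (\<lambda>z. \<phi> (F z)) \<le> ereal ((a + c) * \<theta> + (b + d) * \<mu>)"
    "ext_integral half_line (\<lambda>z. \<phi> (F z)) = ereal ((a + c) * \<theta> + (b + d) * \<mu>) \<Longrightarrow>
      AE z in half_line. F z = G z" if F: "F \<in> feasible \<mu> \<theta>" for F
  proof -
    have nonneg: "0 \<le> F z" if "0 \<le> z" for z
      using F that by (auto simp: feasible_def competitors_def)
    have meas: "(\<lambda>z. \<phi> (F z)) \<in> borel_measurable half_line"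
      using F by (intro measurable_compose[OF _ \<phi>]) (simp add: feasible_def competitors_def)
    have le': "\<phi> (F z) \<le> T F z" if "z \<in> space half_line" for z
      unfolding T_def using that by (intro le nonneg) simp_all
    have int: "integrable half_line (T F)" "(\<integral>z. T F z \<partial>half_line) = (a + c) * \<theta> + (b + d) * \<mu>"
      using T[OF F] by (auto simp: has_bochner_integral_iff)
    show "ext_integral half_line (\<lambda>z. \<phi> (F z)) \<le> ereal ((a + c) * \<theta> + (b + d) * \<mu>)"
      using ext_integral_le_integral(1)[OF meas int(1) le'] int(2) by simp
    assume "ext_integral half_line (\<lambda>z. \<phi> (F z)) = ereal ((a + c) * \<theta> + (b + d) * \<mu>)"
    with ext_integral_le_integral(2)[OF meas int(1) le'] int(2)
    have "AE z in half_line. \<phi> (F z) = T F z" by simp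
    \<comment> \<open>The equality case \<open>eqD\<close> applies on the half line only, so
      \<open>0 \<le> z\<close> has to be carried along.\<close>
    moreover have "AE z in half_line. z \<in> space half_line" by (rule AE_space)
    ultimately show "AE z in half_line. F z = G z"
      by eventually_elim (rule eqD; simp add: nonneg T_def)
  qed
  have "has_bochner_integral half_line (\<lambda>z. \<phi> (G z)) ((a + c) * \<theta> + (b + d) * \<mu>)"
    using T[OF G] by (rule has_bochner_integral_cong[THEN iffD1, rotated -1])
      (auto simp: T_def eq)
  then show val: "ext_integral half_line (\<lambda>z. \<phi> (G z)) = ereal ((a + c) * \<theta> + (b + d) * \<mu>)"
    by (simp add: has_bochner_integral_iff ext_integral_eq_integral)
  show "unique_maximizer (\<lambda>F. ext_integral half_line (\<lambda>z. \<phi> (F z))) (feasible \<mu> \<theta>) G"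
    unfolding unique_maximizer_def is_arg_max_linorder
  proof (intro conjI allI impI)
    fix F assume "F \<in> feasible \<mu> \<theta> \<and> (\<forall>F'. F' \<in> feasible \<mu> \<theta> \<longrightarrow>
      ext_integral half_line (\<lambda>z. \<phi> (F' z)) \<le> ext_integral half_line (\<lambda>z. \<phi> (F z)))"
    then show "AE z in half_line. F z = G z"
      using G bound[of F] val by (metis antisym)
  qed (use G bound(1) val in auto)
qed

section \<open>Comparison of the objectives\<close>

lemma qnorm_power_eq_ext_integral:
  "enn2ereal (qnorm_power q F) = ext_integral half_line (\<lambda>z. F z powr q)"
  by (simp add: qnorm_power_def ext_integral_def zero_ennreal.rep_eq ennreal_neg)

lemma shannon_eq_ext_integral:
  "tsallis_entropy 1 F = ext_integral half_line (\<lambda>z. - (F z * ln (F z)))"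
  by (simp add: tsallis_entropy_def shannon_entropy_def ext_integral_def)

text \<open>The map from the power integral to the entropy subtracts 1 and multiplies by a positive
  number; it is strictly increasing, also when infinity is included.\<close>

lemma tsallis_less_iff:
  assumes "q < 1"
  shows "tsallis_entropy q F < tsallis_entropy q G \<longleftrightarrow> qnorm_power q F < qnorm_power q G"
proof -
  have c: "0 < 1 / (1 - q)" using assms by simp
  have "qnorm_power q F < qnorm_power q G \<longleftrightarrow>
      enn2ereal (qnorm_power q F) < enn2ereal (qnorm_power q G)"
    by (simp add: less_ennreal.rep_eq)
  also have "\<dots> \<longleftrightarrow> tsallis_entropy q F < tsallis_entropy q G"
    using assms c unfolding tsallis_entropy_def
    by (cases "qnorm_power q F"; cases "qnorm_power q G")
       (auto simp: enn2ereal_ennreal one_ereal_def divide_less_cancel)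
  finally show ?thesis by simp
qed

text \<open>A positive power is strictly increasing on the finite values, and infinity corresponds
  to infinity. At \<open>q = 0\<close> this would break down, since \<open>1 / q\<close> is then 0
  by convention.\<close>

lemma qnorm_less_iff:
  assumes "0 < q"
  shows "qnorm q F < qnorm q G \<longleftrightarrow> qnorm_power q F < qnorm_power q G"
proof -
  have "x powr (1 / q) < y powr (1 / q) \<longleftrightarrow> x < y" if "0 \<le> x" "0 \<le> y" for x y :: real
    using assms that powr_less_mono2[of "1 / q" x y] powr_mono2[of "1 / q" y x] by force
  then show ?thesis
    unfolding qnorm_def
    by (cases "qnorm_power q F"; cases "qnorm_power q G") (auto simp: ennreal_less_iff)
qed

section \<open>Strict tangent inequalities\<close>

text \<open>Strict inequality between the geometric and the arithmetic mean of \<open>x\<close> and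
  1 with weights \<open>q\<close> and \<open>1 - q\<close>; the right-hand side is the tangent of
  the power at 1.\<close>

lemma powr_Bernoulli_strict:
  fixes x q :: real
  assumes "0 < q" "q < 1" "0 \<le> x" "x \<noteq> 1"
  shows "x powr q < 1 - q + q * x"
proof (cases "x = 0")
  case True
  then show ?thesis using assms by simp
next
  case False
  then have x: "0 < x" using assms by simp
  define s where "s = 1 - q + q * x"
  \<comment> \<open>These factorizations show that \<open>s\<close> differs from both
    \<open>x\<close> and 1, which makes both logarithmic inequalities below strict.\<close>
  have "s - x = (1 - q) * (1 - x)" "s - 1 = q * (x - 1)"
    by (simp_all add: s_def algebra_simps)
  moreover have "0 < s"
    using mult_pos_pos[OF assms(1) x] assms(2) by (simp add: s_def)
  ultimately have s: "0 < s" "s \<noteq> x" "s \<noteq> 1"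
    using assms by auto
  have strict: "ln t < t - 1" if "0 < t" "t \<noteq> 1" for t :: real
    using ln_le_minus_one[of t] ln_eq_minus_one[of t] that by linarith
  \<comment> \<open>Concavity of the logarithm at the mean \<open>s\<close> of \<open>1\<close> and \<open>x\<close>.\<close>
  have "q * (ln x - ln s) + (1 - q) * (0 - ln s) < q * (x / s - 1) + (1 - q) * (1 / s - 1)"
    using strict[of "x / s"] strict[of "1 / s"] s x assms
    by (intro add_strict_mono mult_strict_left_mono) (auto simp: ln_div)
  also have "\<dots> = 0"
    using s by (simp add: field_simps) (simp add: s_def algebra_simps)
  finally have "q * ln x < ln s" by (simp add: algebra_simps)
  then have "exp (q * ln x) < s" using s by (metis exp_less_mono exp_ln)
  then show ?thesis using x by (simp add: powr_def s_def)
qed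

text \<open>By homogeneity the tangent at \<open>g\<close> reduces to the tangent at 1: apply the
  previous inequality to \<open>y / g\<close> and multiply by \<open>g powr q\<close>.\<close>

lemma powr_tangent_strict:
  fixes y g q :: real
  assumes "0 < q" "q < 1" "0 \<le> y" "0 < g" "y \<noteq> g"
  shows "y powr q < (1 - q) * g powr q + q * g powr (q - 1) * y"
proof -
  have "g powr q * (y / g) powr q < g powr q * (1 - q + q * (y / g))"
    using assms by (intro mult_strict_left_mono powr_Bernoulli_strict) auto
  then show ?thesis
    using assms by (simp add: powr_divide powr_diff field_simps)
qed

text \<open>This is \<open>ln t < t - 1\<close> at \<open>t = g / y\<close>, multiplied by
  \<open>y\<close>; for \<open>y = 0\<close> it reduces to \<open>0 < g\<close>.\<close>

lemma xlnx_tangent_strict: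
  fixes y g :: real
  assumes "0 \<le> y" "0 < g" "y \<noteq> g"
  shows "- (y * ln y) < g - y - y * ln g"
proof (cases "y = 0")
  case False
  then have y: "0 < y" using assms by simp
  have "ln (g / y) < g / y - 1"
    using ln_le_minus_one[of "g / y"] ln_eq_minus_one[of "g / y"] assms y by force
  then have "y * (ln g - ln y) < y * (g / y - 1)"
    using y assms by (simp add: ln_div)
  then show ?thesis using y by (simp add: algebra_simps)
qed (use assms in simp)

section \<open>Integrals over the half line\<close>

text \<open>The half line has infinite measure. This excludes degenerate parameters of the
  candidates and, for \<open>q = 0\<close>, their feasibility.\<close>

lemma not_integrable_half_line_ge:
  fixes f :: "real \<Rightarrow> real"
  assumes "0 < c" "\<And>z. 0 \<le> z \<Longrightarrow> c \<le> f z"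
  shows "\<not> integrable half_line f"
proof
  assume "integrable half_line f"
  then have "integrable half_line (\<lambda>_. c)"
  proof (rule Bochner_Integration.integrable_bound)
    show "AE x in half_line. norm c \<le> norm (f x)"
    proof (rule AE_I2)
      fix z assume "z \<in> space half_line"
      then have "c \<le> f z" by (intro assms) simp
      with assms(1) show "norm c \<le> norm (f z)" by simp
    qed
  qed simp
  with assms have fin: "emeasure half_line {0..} < \<infinity>"
    by (auto simp: integrable_iff_bounded ennreal_mult_less_top)
  have le: "ennreal (real n) \<le> emeasure half_line {0..}" for n
  proof -
    have "ennreal (real n) = emeasure half_line {0..real n}"
      by (subst emeasure_restrict_space) auto
    also have "\<dots> \<le> emeasure half_line {0..}"
      by (intro emeasure_mono) (auto simp: sets_restrict_space)
    finally show ?thesis .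
  qed
  from fin obtain r where r: "0 \<le> r" "emeasure half_line {0..} = ennreal r"
    by (cases "emeasure half_line {0..}") auto
  obtain n where "r < real n" using reals_Archimedean2 by blast
  with le[of n] r show False by (simp add: ennreal_le_iff)
qed

text \<open>For a nonnegative integrand the limit of the primitive gives the nonnegative integral;
  as that is finite, integrability comes for free.\<close>

lemma has_bochner_integral_half_line_FTC:
  fixes f F :: "real \<Rightarrow> real"
  assumes f: "f \<in> borel_measurable borel"
    and deriv: "\<And>z. 0 \<le> z \<Longrightarrow> DERIV F z :> f z"
    and nonneg: "\<And>z. 0 \<le> z \<Longrightarrow> 0 \<le> f z"
    and lim: "(F \<longlongrightarrow> T) at_top"
  shows "has_bochner_integral half_line f (T - F 0)"
proof (rule has_bochner_integral_nn_integral)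
  show "f \<in> borel_measurable half_line"
    using f by (intro measurable_restrict_space1 measurable_completion) simp
  show "AE z in half_line. 0 \<le> f z"
    by (rule AE_I2) (simp add: nonneg)
  have "F 0 \<le> F z" if "0 \<le> z" for z
    using deriv nonneg that by (intro DERIV_nonneg_imp_nondecreasing[OF that]) blast
  then have "F 0 \<le> T"
    by (intro tendsto_lowerbound[OF lim]) (auto simp: eventually_at_top_linorder)
  then show "0 \<le> T - F 0" by simp
  show "(\<integral>\<^sup>+ z. ennreal (f z) \<partial>half_line) = ennreal (T - F 0)"
    using nn_integral_FTC_atLeast[OF f deriv nonneg lim]
    by (subst nn_integral_restrict_space) (auto simp: nn_integral_completion)
qed

text \<open>The condition on \<open>s\<close> makes the exponent \<open>s + 1\<close> of the
  primitive negative, so that the primitive vanishes at infinity.\<close>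

lemma has_bochner_integral_powr_half_line:
  fixes a b s :: real
  assumes "0 < a" "0 < b" "s < - 1"
  shows "has_bochner_integral half_line (\<lambda>z. (a + b * z) powr s) (a powr (s + 1) / (b * (- s - 1)))"
proof -
  define F where "F z = (a + b * z) powr (s + 1) / (b * (s + 1))" for z
  have pos: "0 < a + b * z" if "0 \<le> z" for z
    using assms that by (simp add: add_pos_nonneg)
  have "has_bochner_integral half_line (\<lambda>z. (a + b * z) powr s) (0 - F 0)"
  proof (rule has_bochner_integral_half_line_FTC)
    show "DERIV F z :> (a + b * z) powr s" if "0 \<le> z" for z
      unfolding F_def using pos[OF that] assms
      by (auto intro!: derivative_eq_intros simp: mult.commute)
    show "(F \<longlongrightarrow> 0) at_top"
    proof -
      have "filterlim (\<lambda>z. a + b * z) at_top at_top" using assms by real_asymp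
      then have "((\<lambda>z. (a + b * z) powr (s + 1)) \<longlongrightarrow> 0) at_top"
        using assms by (intro tendsto_neg_powr) auto
      from tendsto_divide[OF this tendsto_const, of "b * (s + 1)"]
      show ?thesis using assms by (simp add: F_def[abs_def])
    qed
  qed auto
  also have "0 - F 0 = a powr (s + 1) / (b * (- s - 1))"
    using assms by (simp add: F_def divide_simps) (simp add: algebra_simps)
  finally show ?thesis .
qed

lemma has_bochner_integral_exp_half_line:
  fixes b :: real
  assumes "0 < b"
  shows "has_bochner_integral half_line (\<lambda>z. exp (- b * z)) (1 / b)"
    and "has_bochner_integral half_line (\<lambda>z. z * exp (- b * z)) (1 / b\<^sup>2)"
proof -
  have "has_bochner_integral half_line (\<lambda>z. exp (- b * z)) (0 - (- exp (- b * 0) / b))"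
  proof (rule has_bochner_integral_half_line_FTC)
    show "((\<lambda>z. - exp (- b * z) / b) \<longlongrightarrow> 0) at_top" using assms by real_asymp
  qed (use assms in \<open>auto intro!: derivative_eq_intros\<close>)
  then show "has_bochner_integral half_line (\<lambda>z. exp (- b * z)) (1 / b)" by simp
  \<comment> \<open>The primitive comes from integration by parts.\<close>
  have "has_bochner_integral half_line (\<lambda>z. z * exp (- b * z))
      (0 - (- (0 / b + 1 / b\<^sup>2) * exp (- b * 0)))"
  proof (rule has_bochner_integral_half_line_FTC)
    show "((\<lambda>z. - (z / b + 1 / b\<^sup>2) * exp (- b * z)) \<longlongrightarrow> 0) at_top" using assms by real_asymp
    show "((\<lambda>z. - (z / b + 1 / b\<^sup>2) * exp (- b * z)) has_real_derivative z * exp (- b * z)) (at z)"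
      for z using assms
      by (auto intro!: derivative_eq_intros simp: field_simps power2_eq_square)
  qed (use assms in auto)
  then show "has_bochner_integral half_line (\<lambda>z. z * exp (- b * z)) (1 / b\<^sup>2)" by simp
qed

lemma has_bochner_integral_half_line_cong:
  fixes f g :: "real \<Rightarrow> real"
  assumes "has_bochner_integral half_line f x" "\<And>z. 0 \<le> z \<Longrightarrow> f z = g z" "x = y"
  shows "has_bochner_integral half_line g y"
  using assms by (subst has_bochner_integral_cong[where g = f and y = x]) auto

section \<open>The power-law candidate for \<open>q < 1\<close>\<close>

text \<open>In this form the power \<open>q - 1\<close> of the candidate is visibly the affine
  function \<open>\<alpha> + \<beta> * z\<close>.\<close>

lemma G_star_eq:
  assumes "0 < \<alpha>" "0 \<le> \<beta>" "0 \<le> z"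
  shows "G_star q \<alpha> \<beta> z = (\<alpha> + \<beta> * z) powr (1 / (q - 1))"
proof -
  have "\<alpha> + \<beta> * z = \<alpha> * (1 + \<beta> / \<alpha> * z)" "0 \<le> 1 + \<beta> / \<alpha> * z"
    using assms by (simp_all add: field_simps)
  then show ?thesis using assms by (simp add: G_star_def powr_mult)
qed

text \<open>For \<open>\<alpha> = 0\<close> the candidate is identically zero, because
  \<open>powr\<close> has value 0 at base 0, and this contradicts the positive mass. For
  \<open>\<beta> = 0\<close> it is a positive constant, hence not integrable.\<close>

lemma G_star_feasible_params_pos:
  assumes G: "G_star q \<alpha> \<beta> \<in> feasible \<mu> \<theta>" and "0 < \<theta>" "0 \<le> \<alpha>" "0 \<le> \<beta>"
  shows "0 < \<alpha>" "0 < \<beta>"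
proof -
  have int: "has_bochner_integral half_line (G_star q \<alpha> \<beta>) \<theta>"
    using G by (simp add: feasible_def)
  have "\<alpha> \<noteq> 0"
  proof
    assume "\<alpha> = 0"
    then have "has_bochner_integral half_line (\<lambda>_. 0 :: real) \<theta>"
      using int by (simp add: G_star_def[abs_def])
    then show False using \<open>0 < \<theta>\<close> by (simp add: has_bochner_integral_iff)
  qed
  then show \<alpha>: "0 < \<alpha>" using assms by simp
  have "\<beta> \<noteq> 0"
    using not_integrable_half_line_ge[of "\<alpha> powr (1 / (q - 1))" "G_star q \<alpha> \<beta>"] int \<alpha>
    by (auto simp: G_star_def has_bochner_integral_iff)
  then show "0 < \<beta>" using assms by simp
qed

lemma G_star_maximizer:
  assumes q: "0 \<le> q" "q < 1" and pos: "0 < \<alpha>" "0 \<le> \<beta>"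
    and G: "G_star q \<alpha> \<beta> \<in> feasible \<mu> \<theta>"
  shows "unique_maximizer (tsallis_entropy q) (feasible \<mu> \<theta>) (G_star q \<alpha> \<beta>)"
    and "qnorm_power q (G_star q \<alpha> \<beta>) = ennreal (\<alpha> * \<theta> + \<beta> * \<mu>)"
proof -
  define g where "g = G_star q \<alpha> \<beta>"
  note G = G[folded g_def]
  have w: "0 < \<alpha> + \<beta> * z" if "0 \<le> z" for z
    using pos that by (simp add: add_pos_nonneg)
  have g: "g z = (\<alpha> + \<beta> * z) powr (1 / (q - 1))" if "0 \<le> z" for z
    using G_star_eq[OF pos that] by (simp add: g_def)
  have g_pos: "0 < g z" if "0 \<le> z" for z
    using g[OF that] w[OF that] by simp
  have g_q1: "g z powr (q - 1) = \<alpha> + \<beta> * z" if "0 \<le> z" for z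
    using g[OF that] w[OF that] q by (simp add: powr_powr)
  have g_q: "g z powr q = (\<alpha> + \<beta> * z) * g z" if "0 \<le> z" for z
    using g_q1[OF that] g_pos[OF that] by (simp add: powr_diff field_simps)
  have "q \<noteq> 0"
  proof
    assume "q = 0"
    have "integrable half_line (\<lambda>z. \<alpha> * g z + \<beta> * (z * g z))"
      using G by (intro Bochner_Integration.integrable_add integrable_mult_right)
        (auto simp: feasible_def has_bochner_integral_iff)
    moreover have "\<not> integrable half_line (\<lambda>z. \<alpha> * g z + \<beta> * (z * g z))"
    proof (rule not_integrable_half_line_ge[of 1])
      show "1 \<le> \<alpha> * g z + \<beta> * (z * g z)" if "0 \<le> z" for z
        using g_q[OF that] g_pos[OF that] \<open>q = 0\<close> by (simp add: algebra_simps)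
    qed simp
    ultimately show False by contradiction
  qed
  with q have q0: "0 < q" by simp
  \<comment> \<open>The tangent of the power at \<open>g z\<close>, with \<open>g z powr q\<close>
    and \<open>g z powr (q - 1)\<close> already replaced so as to match
    \<open>tangent_maximizer\<close>. The coefficients add up to \<open>a + c = \<alpha>\<close> and
    \<open>b + d = \<beta>\<close>, which gives the maximal value.\<close>
  define T where "T y z = ((1 - q) * \<alpha> + (1 - q) * \<beta> * z) * g z + (q * \<alpha> + q * \<beta> * z) * y" for y z
  have T: "T y z = (1 - q) * g z powr q + q * g z powr (q - 1) * y" if "0 \<le> z" for y z
    using that by (simp add: T_def g_q g_q1 algebra_simps)
  have T_eq: "g z powr q = T (g z) z" if "0 \<le> z" for z
    using that by (simp add: T_def g_q algebra_simps)
  have T_less: "y powr q < T y z" if "0 \<le> y" "0 \<le> z" "y \<noteq> g z" for y z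
    using powr_tangent_strict[OF q0 q(2) that(1) g_pos[OF that(2)] that(3)] that by (simp add: T)
  have T_le: "y powr q \<le> T y z" if "0 \<le> y" "0 \<le> z" for y z
    using T_less[OF that] T_eq[OF that(2)] by (cases "y = g z") auto
  have T_eqD: "y = g z" if "0 \<le> y" "0 \<le> z" "y powr q = T y z" for y z
    using T_less[OF that(1,2)] that(3) by auto
  have meas: "(\<lambda>y. y powr q) \<in> borel_measurable borel" by simp
  note max = tangent_maximizer[OF G meas T_le[unfolded T_def] T_eqD[unfolded T_def]
    T_eq[unfolded T_def]]
  have "unique_maximizer (tsallis_entropy q) (feasible \<mu> \<theta>) g \<longleftrightarrow>
      unique_maximizer (\<lambda>F. ext_integral half_line (\<lambda>z. F z powr q)) (feasible \<mu> \<theta>) g"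
    by (rule unique_maximizer_cong_order)
      (simp add: tsallis_less_iff[OF q(2)] less_ennreal.rep_eq qnorm_power_eq_ext_integral)
  with max(1) show "unique_maximizer (tsallis_entropy q) (feasible \<mu> \<theta>) (G_star q \<alpha> \<beta>)"
    by (simp add: g_def)
  have "enn2ereal (qnorm_power q g) = ereal (\<alpha> * \<theta> + \<beta> * \<mu>)"
    using max(2) by (simp add: qnorm_power_eq_ext_integral algebra_simps)
  then show "qnorm_power q (G_star q \<alpha> \<beta>) = ennreal (\<alpha> * \<theta> + \<beta> * \<mu>)"
    by (cases "qnorm_power q g") (auto simp: g_def enn2ereal_ennreal)
qed

text \<open>With \<open>w z = \<alpha> + \<beta> * z\<close> and \<open>s = 1 / (q - 1)\<close>,
  solving for \<open>z\<close> turns \<open>z * w z powr s\<close> into a difference of the powers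
  \<open>s + 1\<close> and \<open>s\<close> of \<open>w\<close>. The bound \<open>1 / 2 < q\<close>
  is what makes \<open>s + 1 < - 1\<close>, so that the mean is finite.\<close>

lemma G_star_feasible:
  assumes q: "1 / 2 < q" "q < 1" and pos: "0 < \<alpha>" "0 < \<beta>"
  shows "G_star q \<alpha> \<beta> \<in> feasible
    ((q - 1)\<^sup>2 / (q * (2 * q - 1)) * (\<alpha> powr ((2 * q - 1) / (q - 1)) / \<beta>\<^sup>2))
    (\<alpha> powr (q / (q - 1)) / \<beta> * ((1 - q) / q))"
proof -
  define s where "s = 1 / (q - 1)"
  define w where "w z = \<alpha> + \<beta> * z" for z
  have w: "0 < w z" if "0 \<le> z" for z
    using pos that by (simp add: w_def add_pos_nonneg)
  have g: "G_star q \<alpha> \<beta> z = w z powr s" if "0 \<le> z" for z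
    using G_star_eq[of \<alpha> \<beta> z q] pos that by (simp add: w_def s_def)
  have s: "s < - 2" "s + 1 = q / (q - 1)" "s + 2 = (2 * q - 1) / (q - 1)"
    using q by (simp_all add: s_def field_simps)
  have I1: "has_bochner_integral half_line (\<lambda>z. w z powr s) (\<alpha> powr (s + 1) / (\<beta> * (- s - 1)))"
    and I2: "has_bochner_integral half_line (\<lambda>z. w z powr (s + 1))
      (\<alpha> powr (s + 1 + 1) / (\<beta> * (- (s + 1) - 1)))"
    unfolding w_def using pos s by (intro has_bochner_integral_powr_half_line; simp)+
  have "has_bochner_integral half_line (G_star q \<alpha> \<beta>) (\<alpha> powr (q / (q - 1)) / \<beta> * ((1 - q) / q))"
  proof (rule has_bochner_integral_half_line_cong[OF I1])
    have "- s - 1 = q / (1 - q)" using q by (simp add: s_def field_simps)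
    then show "\<alpha> powr (s + 1) / (\<beta> * (- s - 1)) = \<alpha> powr (q / (q - 1)) / \<beta> * ((1 - q) / q)"
      using s by simp
  qed (simp add: g)
  moreover have "has_bochner_integral half_line (\<lambda>z. z * G_star q \<alpha> \<beta> z)
    ((q - 1)\<^sup>2 / (q * (2 * q - 1)) * (\<alpha> powr ((2 * q - 1) / (q - 1)) / \<beta>\<^sup>2))"
  proof (rule has_bochner_integral_half_line_cong)
    show "has_bochner_integral half_line (\<lambda>z. (w z powr (s + 1) - \<alpha> * w z powr s) / \<beta>)
      ((\<alpha> powr (s + 1 + 1) / (\<beta> * (- (s + 1) - 1)) - \<alpha> * (\<alpha> powr (s + 1) / (\<beta> * (- s - 1)))) / \<beta>)"
      by (intro has_bochner_integral_divide has_bochner_integral_diff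
          has_bochner_integral_mult_right I1 I2)
    show "(w z powr (s + 1) - \<alpha> * w z powr s) / \<beta> = z * G_star q \<alpha> \<beta> z" if "0 \<le> z" for z
    proof -
      have "w z powr (s + 1) = w z powr s * w z"
        using w[OF that] by (simp add: powr_add)
      then show ?thesis using pos g[OF that] by (simp add: w_def field_simps)
    qed
    define A where "A = \<alpha> powr ((2 * q - 1) / (q - 1))"
    have A: "\<alpha> powr (s + 1 + 1) = A" "\<alpha> * \<alpha> powr (s + 1) = A"
      using pos s(3) by (simp_all add: A_def powr_add flip: s(3)) (simp add: power2_eq_square)
    have r: "- (s + 1) - 1 = (2 * q - 1) / (1 - q)" "- s - 1 = q / (1 - q)"
      using q by (simp_all add: s_def field_simps)
    have "(A / (\<beta> * (x / y)) - A / (\<beta> * (u / y))) / \<beta> = (A / \<beta>\<^sup>2) * (y / x - y / u)" for x y u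
      by (simp add: power2_eq_square right_diff_distrib diff_divide_distrib mult_ac)
    then have "(A / (\<beta> * ((2 * q - 1) / (1 - q))) - A / (\<beta> * (q / (1 - q)))) / \<beta>
        = (A / \<beta>\<^sup>2) * ((1 - q) / (2 * q - 1) - (1 - q) / q)" .
    also have "(1 - q) / (2 * q - 1) - (1 - q) / q = (q - 1)\<^sup>2 / (q * (2 * q - 1))"
      using q by (simp add: diff_frac_eq power2_eq_square) (simp add: algebra_simps)
    finally show "(\<alpha> powr (s + 1 + 1) / (\<beta> * (- (s + 1) - 1))
          - \<alpha> * (\<alpha> powr (s + 1) / (\<beta> * (- s - 1)))) / \<beta>
        = (q - 1)\<^sup>2 / (q * (2 * q - 1)) * (\<alpha> powr ((2 * q - 1) / (q - 1)) / \<beta>\<^sup>2)"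
      unfolding r A(1) times_divide_eq_right A(2) A_def[symmetric] by (simp add: mult.commute)
  qed
  ultimately show ?thesis
    by (auto simp: feasible_def competitors_def has_bochner_integral_iff G_star_def
        intro: borel_measurable_integrable)
qed

text \<open>Serves to read off the parameter formulas: a feasible candidate is also feasible for its
  explicitly computed moments.\<close>

lemma feasible_unique:
  assumes "G \<in> feasible \<mu> \<theta>" "G \<in> feasible \<mu>' \<theta>'"
  shows "\<mu> = \<mu>'" "\<theta> = \<theta>'"
  using assms by (auto simp: feasible_def has_bochner_integral_iff)

lemma G_star_exists:
  assumes q: "1 / 2 < q" "q < 1" and pos: "0 < \<mu>" "0 < \<theta>"
  shows "\<exists>\<alpha>>0. \<exists>\<beta>>0. G_star q \<alpha> \<beta> \<in> feasible \<mu> \<theta>"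
proof -
  \<comment> \<open>Here \<open>k\<close> is the ratio of \<beta> to \<alpha>: dividing the two
    moment formulas gives \<open>\<mu> / \<theta> = (1 - q) / (2 * q - 1) * (\<alpha> /
    \<beta>)\<close>. Inserting \<open>\<beta> = k * \<alpha>\<close> into the formula for \<theta>
    then determines \<alpha>.\<close>
  define k where "k = \<theta> * (1 - q) / (\<mu> * (2 * q - 1))"
  define \<alpha> where "\<alpha> = (\<theta> * k * q / (1 - q)) powr (q - 1)"
  define \<beta> where "\<beta> = k * \<alpha>"
  have k: "0 < k" using q pos by (simp add: k_def)
  have \<alpha>: "0 < \<alpha>" using q pos k by (simp add: \<alpha>_def)
  have \<beta>: "0 < \<beta>" using \<alpha> k by (simp add: \<beta>_def)
  have s: "q / (q - 1) = 1 / (q - 1) + 1" "(2 * q - 1) / (q - 1) = 1 / (q - 1) + 1 + 1"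
    using q by (simp_all add: field_simps)
  have "\<alpha> powr (1 / (q - 1)) = \<theta> * k * q / (1 - q)"
    using q pos k by (simp add: \<alpha>_def powr_powr)
  then have A: "\<alpha> powr (q / (q - 1)) = \<theta> * k * q / (1 - q) * \<alpha>"
    "\<alpha> powr ((2 * q - 1) / (q - 1)) = \<theta> * k * q / (1 - q) * \<alpha> * \<alpha>"
    unfolding s using \<alpha> by (simp_all add: powr_add power2_eq_square del: add_divide_eq_iff)
  have "\<alpha> powr (q / (q - 1)) / \<beta> * ((1 - q) / q) = \<theta>"
    unfolding A \<beta>_def using \<alpha> k q by simp
  moreover have "(q - 1)\<^sup>2 / (q * (2 * q - 1)) * (\<alpha> powr ((2 * q - 1) / (q - 1)) / \<beta>\<^sup>2) = \<mu>"
  proof -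
    have "(q - 1)\<^sup>2 / (q * (2 * q - 1)) * (\<alpha> powr ((2 * q - 1) / (q - 1)) / \<beta>\<^sup>2)
        = (1 - q)\<^sup>2 / (q * (2 * q - 1)) * (\<theta> * q / ((1 - q) * k))"
      unfolding A \<beta>_def power2_commute[of q 1] using \<alpha> k q by (simp add: power2_eq_square)
    also have "\<dots> = \<theta> * (1 - q) / ((2 * q - 1) * k)"
      using q k by (simp add: power2_eq_square)
    also have "\<dots> = \<mu>"
      unfolding k_def using q pos by simp
    finally show ?thesis .
  qed
  ultimately show ?thesis
    using G_star_feasible[OF q \<alpha> \<beta>] \<alpha> \<beta> by auto
qed

section \<open>The exponential candidate for \<open>q = 1\<close>\<close>

lemma G_star1_feasible:
  assumes "0 \<le> \<alpha>" "0 < \<beta>"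
  shows "G_star1 \<alpha> \<beta> \<in> feasible (\<alpha> / \<beta>\<^sup>2) (\<alpha> / \<beta>)"
proof -
  have "has_bochner_integral half_line (\<lambda>z. z * G_star1 \<alpha> \<beta> z) (\<alpha> / \<beta>\<^sup>2)"
    using has_bochner_integral_mult_right[OF has_bochner_integral_exp_half_line(2)[OF assms(2)], of \<alpha>]
    by (simp add: G_star1_def[abs_def] mult_ac)
  moreover have "has_bochner_integral half_line (G_star1 \<alpha> \<beta>) (\<alpha> / \<beta>)"
    using has_bochner_integral_mult_right[OF has_bochner_integral_exp_half_line(1)[OF assms(2)], of \<alpha>]
    by (simp add: G_star1_def[abs_def])
  ultimately show ?thesis
    using assms by (auto simp: feasible_def competitors_def has_bochner_integral_iff G_star1_def
        intro: borel_measurable_integrable)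
qed

text \<open>No signs are presupposed: the value at 0 gives \<open>0 \<le> \<alpha>\<close>, positive
  mass excludes \<open>\<alpha> = 0\<close>, and for \<open>\<beta> \<le> 0\<close> the candidate
  would stay above \<alpha> on the half line.\<close>

lemma G_star1_feasible_params_pos:
  assumes G: "G_star1 \<alpha> \<beta> \<in> feasible \<mu> \<theta>" and "0 < \<theta>"
  shows "0 < \<alpha>" "0 < \<beta>"
proof -
  have int: "has_bochner_integral half_line (G_star1 \<alpha> \<beta>) \<theta>" and "0 \<le> G_star1 \<alpha> \<beta> 0"
    using G by (auto simp: feasible_def competitors_def)
  then have "0 \<le> \<alpha>" by (simp add: G_star1_def)
  moreover have "\<alpha> \<noteq> 0"
  proof
    assume "\<alpha> = 0"
    then have "has_bochner_integral half_line (\<lambda>_. 0 :: real) \<theta>"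
      using int by (simp add: G_star1_def[abs_def])
    then show False using \<open>0 < \<theta>\<close> by (simp add: has_bochner_integral_iff)
  qed
  ultimately show \<alpha>: "0 < \<alpha>" by simp
  show "0 < \<beta>"
  proof (rule ccontr)
    assume "\<not> 0 < \<beta>"
    then have "\<alpha> \<le> G_star1 \<alpha> \<beta> z" if "0 \<le> z" for z
      using \<alpha> that by (simp add: G_star1_def mult_nonpos_nonneg)
    with not_integrable_half_line_ge[OF \<alpha>] int show False
      by (auto simp: has_bochner_integral_iff)
  qed
qed

lemma G_star1_maximizer:
  assumes \<alpha>: "0 < \<alpha>" and G: "G_star1 \<alpha> \<beta> \<in> feasible \<mu> \<theta>"
  shows "unique_maximizer (tsallis_entropy 1) (feasible \<mu> \<theta>) (G_star1 \<alpha> \<beta>)"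
    and "tsallis_entropy 1 (G_star1 \<alpha> \<beta>) = ereal (\<beta> * \<mu> - \<theta> * ln \<alpha>)"
proof -
  define g where "g = G_star1 \<alpha> \<beta>"
  note G = G[folded g_def]
  have g_pos: "0 < g z" for z using \<alpha> by (simp add: g_def G_star1_def)
  have ln_g: "ln (g z) = ln \<alpha> - \<beta> * z" for z using \<alpha> by (simp add: g_def G_star1_def ln_mult)
  \<comment> \<open>The slope of \<open>- (y * ln y)\<close> at \<open>g z\<close> is
    \<open>- 1 - ln (g z)\<close>, affine in \<open>z\<close>. The summand \<open>0 * z\<close> only
    supplies the coefficient \<open>d = 0\<close> of \<open>tangent_maximizer\<close>.\<close>
  define T where "T y z = (1 + 0 * z) * g z + ((- 1 - ln \<alpha>) + \<beta> * z) * y" for y z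
  have T: "T y z = g z - y - y * ln (g z)" for y z
    by (simp add: T_def ln_g algebra_simps)
  have T_eq: "- (g z * ln (g z)) = T (g z) z" for z
    by (simp add: T)
  have T_less: "- (y * ln y) < T y z" if "0 \<le> y" "y \<noteq> g z" for y z
    using xlnx_tangent_strict[OF that(1) g_pos that(2)] by (simp add: T)
  have T_le: "- (y * ln y) \<le> T y z" if "0 \<le> y" for y z
    using T_less[OF that, of z] T_eq[of z] by (cases "y = g z") auto
  have T_eqD: "y = g z" if "0 \<le> y" "- (y * ln y) = T y z" for y z
    using T_less[OF that(1)] that(2) by force
  have meas: "(\<lambda>y. - (y * ln y) :: real) \<in> borel_measurable borel" by simp
  note max = tangent_maximizer[OF G meas T_le[unfolded T_def] T_eqD[unfolded T_def]
    T_eq[unfolded T_def]]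
  show "unique_maximizer (tsallis_entropy 1) (feasible \<mu> \<theta>) (G_star1 \<alpha> \<beta>)"
    using max(1) by (simp add: shannon_eq_ext_integral[abs_def] g_def)
  show "tsallis_entropy 1 (G_star1 \<alpha> \<beta>) = ereal (\<beta> * \<mu> - \<theta> * ln \<alpha>)"
    using max(2) by (simp add: shannon_eq_ext_integral g_def algebra_simps)
qed

theorem proposition1:
  fixes \<mu> \<theta> :: real
  assumes "\<mu> > 0" and "\<theta> > 0"
  shows
    "(\<forall>q. 0 < q \<and> q < 1 \<longrightarrow>
        (\<forall>G. is_arg_max (tsallis_entropy q) (\<lambda>F. F \<in> feasible \<mu> \<theta>) G \<longleftrightarrow>
             is_arg_max (qnorm q) (\<lambda>F. F \<in> feasible \<mu> \<theta>) G)) \<and>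
     (\<forall>q. 0 \<le> q \<and> q < 1 \<longrightarrow>
        (\<forall>\<alpha>\<ge>0. \<forall>\<beta>\<ge>0. G_star q \<alpha> \<beta> \<in> feasible \<mu> \<theta> \<longrightarrow>
           unique_maximizer (tsallis_entropy q) (feasible \<mu> \<theta>) (G_star q \<alpha> \<beta>))) \<and>
     (\<forall>q. 1 / 2 < q \<and> q < 1 \<longrightarrow>
        (\<exists>\<alpha>>0. \<exists>\<beta>>0.
           unique_maximizer (tsallis_entropy q) (feasible \<mu> \<theta>) (G_star q \<alpha> \<beta>)) \<and>
        (\<forall>\<alpha>\<ge>0. \<forall>\<beta>\<ge>0. G_star q \<alpha> \<beta> \<in> feasible \<mu> \<theta> \<longrightarrow>
           \<mu> = (q - 1)^2 / (q * (2 * q - 1)) * (\<alpha> powr ((2 * q - 1) / (q - 1)) / \<beta>^2) \<and>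
           \<theta> = \<alpha> powr (q / (q - 1)) / \<beta> * ((1 - q) / q) \<and>
           qnorm_power q (G_star q \<alpha> \<beta>) =
             ennreal (\<alpha> powr ((2 * q - 1) / (q - 1)) / \<beta> * ((1 - q) / (2 * q - 1))))) \<and>
     (\<exists>\<alpha> \<beta>. unique_maximizer (tsallis_entropy 1) (feasible \<mu> \<theta>) (G_star1 \<alpha> \<beta>)) \<and>
     (\<forall>\<alpha> \<beta>. G_star1 \<alpha> \<beta> \<in> feasible \<mu> \<theta> \<longrightarrow>
        unique_maximizer (tsallis_entropy 1) (feasible \<mu> \<theta>) (G_star1 \<alpha> \<beta>) \<and>
        \<mu> = \<alpha> / \<beta>^2 \<and>
        \<theta> = \<alpha> / \<beta> \<and>
        tsallis_entropy 1 (G_star1 \<alpha> \<beta>) = ereal (- (\<alpha> / \<beta>) * ln \<alpha> + \<alpha> / \<beta>))"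
proof (intro conjI allI impI; (elim conjE)?)
  fix q :: real and G assume "0 < q" "q < 1"
  then show "is_arg_max (tsallis_entropy q) (\<lambda>F. F \<in> feasible \<mu> \<theta>) G \<longleftrightarrow>
      is_arg_max (qnorm q) (\<lambda>F. F \<in> feasible \<mu> \<theta>) G"
    by (intro is_arg_max_cong_order) (simp add: tsallis_less_iff qnorm_less_iff)
next
  fix q \<alpha> \<beta> :: real assume "0 \<le> q" "q < 1" "0 \<le> \<alpha>" "0 \<le> \<beta>" "G_star q \<alpha> \<beta> \<in> feasible \<mu> \<theta>"
  then show "unique_maximizer (tsallis_entropy q) (feasible \<mu> \<theta>) (G_star q \<alpha> \<beta>)"
    using G_star_feasible_params_pos(1) assms(2) by (blast intro: G_star_maximizer(1))
next
  fix q :: real assume q: "1 / 2 < q" "q < 1"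
  then obtain \<alpha> \<beta> where "0 < \<alpha>" "0 < \<beta>" "G_star q \<alpha> \<beta> \<in> feasible \<mu> \<theta>"
    using G_star_exists assms by blast
  moreover from this q have "unique_maximizer (tsallis_entropy q) (feasible \<mu> \<theta>) (G_star q \<alpha> \<beta>)"
    by (intro G_star_maximizer(1)) auto
  ultimately show "\<exists>\<alpha>>0. \<exists>\<beta>>0.
      unique_maximizer (tsallis_entropy q) (feasible \<mu> \<theta>) (G_star q \<alpha> \<beta>)"
    by blast
next
  fix q \<alpha> \<beta> :: real assume q: "1 / 2 < q" "q < 1" and "0 \<le> \<alpha>" "0 \<le> \<beta>"
    and G: "G_star q \<alpha> \<beta> \<in> feasible \<mu> \<theta>"
  then have pos: "0 < \<alpha>" "0 < \<beta>" using G_star_feasible_params_pos assms(2) by blast+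
  show \<mu>: "\<mu> = (q - 1)\<^sup>2 / (q * (2 * q - 1)) * (\<alpha> powr ((2 * q - 1) / (q - 1)) / \<beta>\<^sup>2)"
    and \<theta>: "\<theta> = \<alpha> powr (q / (q - 1)) / \<beta> * ((1 - q) / q)"
    using feasible_unique[OF G G_star_feasible[OF q pos]] by simp_all
  \<comment> \<open>The power integral equals \<open>\<alpha> * \<theta> + \<beta> * \<mu>\<close>;
    after inserting the moment formulas both terms are multiples of
    \<open>A / \<beta>\<close>.\<close>
  define A where "A = \<alpha> powr ((2 * q - 1) / (q - 1))"
  have "(2 * q - 1) / (q - 1) = q / (q - 1) + 1" using q by (simp add: field_simps)
  then have A: "\<alpha> * \<alpha> powr (q / (q - 1)) = A" using pos by (simp add: A_def powr_add)
  have "\<alpha> * \<theta> = A / \<beta> * ((1 - q) / q)"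
    unfolding \<theta> A[symmetric] by simp
  moreover have "\<beta> * \<mu> = A / \<beta> * ((q - 1)\<^sup>2 / (q * (2 * q - 1)))"
    unfolding \<mu> A_def[symmetric] using pos by (simp add: power2_eq_square mult_ac)
  ultimately have "\<alpha> * \<theta> + \<beta> * \<mu> = A / \<beta> * ((1 - q) / q + (q - 1)\<^sup>2 / (q * (2 * q - 1)))"
    by (simp only: distrib_left)
  also have "(1 - q) / q + (q - 1)\<^sup>2 / (q * (2 * q - 1)) = (1 - q) / (2 * q - 1)"
    using q by (simp add: divide_simps) (simp add: power2_eq_square algebra_simps)
  finally show "qnorm_power q (G_star q \<alpha> \<beta>) =
      ennreal (\<alpha> powr ((2 * q - 1) / (q - 1)) / \<beta> * ((1 - q) / (2 * q - 1)))"
    using G_star_maximizer(2)[OF _ q(2) pos(1) _ G] q pos by (simp add: A_def)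
next
  \<comment> \<open>The quotient of the moments \<open>\<alpha> / \<beta>\<close> and
    \<open>\<alpha> / \<beta>\<^sup>2\<close> is \<beta>; then
    \<open>\<alpha> = \<theta> * \<beta>\<close>.\<close>
  define \<beta> where "\<beta> = \<theta> / \<mu>"
  have \<beta>: "0 < \<beta>" using assms by (simp add: \<beta>_def)
  have "(\<theta> * \<beta>) / \<beta>\<^sup>2 = \<mu>" "(\<theta> * \<beta>) / \<beta> = \<theta>"
    using assms by (simp_all add: \<beta>_def power2_eq_square)
  then have "G_star1 (\<theta> * \<beta>) \<beta> \<in> feasible \<mu> \<theta>"
    using G_star1_feasible[of "\<theta> * \<beta>" \<beta>] assms \<beta> by simp
  then have "unique_maximizer (tsallis_entropy 1) (feasible \<mu> \<theta>) (G_star1 (\<theta> * \<beta>) \<beta>)"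
    using assms \<beta> by (intro G_star1_maximizer(1)) auto
  then show "\<exists>\<alpha> \<beta>. unique_maximizer (tsallis_entropy 1) (feasible \<mu> \<theta>) (G_star1 \<alpha> \<beta>)"
    by blast
next
  fix \<alpha> \<beta> :: real assume G: "G_star1 \<alpha> \<beta> \<in> feasible \<mu> \<theta>"
  from G_star1_feasible_params_pos[OF G assms(2)] have pos: "0 < \<alpha>" "0 < \<beta>" by auto
  show "unique_maximizer (tsallis_entropy 1) (feasible \<mu> \<theta>) (G_star1 \<alpha> \<beta>)"
    by (rule G_star1_maximizer(1)[OF pos(1) G])
  show \<mu>: "\<mu> = \<alpha> / \<beta>\<^sup>2" and \<theta>: "\<theta> = \<alpha> / \<beta>"
    using feasible_unique[OF G G_star1_feasible] pos by auto
  \<comment> \<open>This is the second summand of the entropy; it agrees with \<alpha> only for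
    \<open>\<beta> = 1\<close>.\<close>
  have "\<beta> * \<mu> = \<alpha> / \<beta>" using pos by (simp add: \<mu> power2_eq_square)
  then show "tsallis_entropy 1 (G_star1 \<alpha> \<beta>) = ereal (- (\<alpha> / \<beta>) * ln \<alpha> + \<alpha> / \<beta>)"
    using G_star1_maximizer(2)[OF pos(1) G] by (simp add: \<theta>)
qed

end
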